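(* Let $A$ be a commutative associative superalgebra with parity $p$. The odd Poisson superalgebra structures on $A$ (with the given commutative associative product) are in bijective correspondence with the set $$\{X\in W_1^{\mathrm{as}}(A)_{\bar1}\ :\ [X,X]=0\},$$ where the bracket corresponding to $X$ is $[a,b]=(-1)^{p(a)+\bar1}X(a,b)$, $a,b\in A$.
   Context: All spaces are over a field $\mathbb F$ of characteristic $0$. For a superspace $U$ with parity $p$, $\Pi U$ is the same space with parity $p+\bar1$. Universal Lie superalgebra of a superspace $A$ with parity $p$: $W(A)=\bigoplus_{k\ge-1}W_k(A)$, $W_k(A)=\mathrm{Hom}(S^{k+1}(A),A)$ (supersymmetric $(k+1)$-linear maps), with induced parity $p$. For $X\in W_h(A)$, $Y\in W_{k-h}(A)$ put $$(X\Box Y)(v_0,\dots,v_k)=\sum_{\substack{i_0<\dots<i_{k-h}\\ i_{k-h+1}<\dots<i_k}}\epsilon_v(i_0,\dots,i_k)X(Y(v_{i_0},\dots,v_{i_{k-h}}),v_{i_{k-h+1}},\dots,v_{i_k}),$$ the sum being over permutations of $(0,\dots,k)$, where $\epsilon_v(i_0,\dots,i_k)=(-1)^M$ with $M$ the number of interchanges of indices of odd $v_i$'s. $[X,Y]=X\Box Y-(-1)^{p(X)p(Y)}Y\Box X$ is a Lie superalgebra bracket; for $Y\in W_{-1}(A)=A$, $[X,Y](v_1,\dots,v_k)=X(Y,v_1,\dots,v_k)$. $\mathrm{Der}(A)$ is the Lie superalgebra of linear maps $X:A\to A$ with $X(ab)=X(a)b+(-1)^{p(a)p(b)}X(b)a$.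 $W^{\mathrm{as}}(A)\subset W(A)$ is its full prolongation: $W^{\mathrm{as}}_{-1}(A)=A$, $W_0^{\mathrm{as}}(A)=\mathrm{Der}(A)$, $W_k^{\mathrm{as}}(A)=\{X\in W_k(A):[X,A]\subset W^{\mathrm{as}}_{k-1}(A)\}$ for $k\ge1$. The subscript $\bar1$ denotes odd elements. An odd Poisson (Gerstenhaber) superalgebra structure on $A$ is a bracket making $\Pi A$ a Lie superalgebra and satisfying $[a,bc]=[a,b]c+(-1)^{(p(a)+\bar1)p(b)}b[a,c]$. *)

theory Defs
  imports Complex_Main "HOL-Library.Z2"
begin

text \<open>Parities live in \<^typ>\<open>bit\<close>, the field with two elements. For homogeneous elements of
  parities \<^term>\<open>i\<close> and \<^term>\<open>j\<close>, the sign $(-1)^{ij}$ is \<^term>\<open>psign (i * j)\<close>.\<close>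

definition psign :: "bit \<Rightarrow> 'f::field_char_0" where
  "psign i = (if i = 0 then 1 else - 1)"

locale superspace = vector_space scale
  for scale :: "'f::field_char_0 \<Rightarrow> 'a::ab_group_add \<Rightarrow> 'a" (infixr \<open>*s\<close> 75) +
  fixes G :: "bit \<Rightarrow> 'a set"
  assumes subspace_G: "subspace (G i)"
    and G_inter: "G 0 \<inter> G 1 = {0}"
    and G_span: "\<exists>b\<in>G 0. \<exists>c\<in>G 1. a = b + c"

text \<open>The grading of $\Pi A$, with parities reversed.\<close>

definition parity_rev :: "(bit \<Rightarrow> 'a set) \<Rightarrow> bit \<Rightarrow> 'a set" where
  "parity_rev G i = G (i + 1)"

locale lie_superalgebra = superspace scale G
  for scale :: "'f::field_char_0 \<Rightarrow> 'a::ab_group_add \<Rightarrow> 'a" (infixr \<open>*s\<close> 75)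
    and G :: "bit \<Rightarrow> 'a set" +
  fixes br :: "'a \<Rightarrow> 'a \<Rightarrow> 'a"
  assumes br_linear_right: "Vector_Spaces.linear scale scale (\<lambda>b. br a b)"
    and br_linear_left: "Vector_Spaces.linear scale scale (\<lambda>a. br a b)"
    and br_grading: "a \<in> G i \<Longrightarrow> b \<in> G j \<Longrightarrow> br a b \<in> G (i + j)"
    and br_skew: "a \<in> G i \<Longrightarrow> b \<in> G j \<Longrightarrow> br a b = - (psign (i * j) *s br b a)"
    and br_jacobi: "a \<in> G i \<Longrightarrow> b \<in> G j \<Longrightarrow> c \<in> G l \<Longrightarrow>
      br a (br b c) = br (br a b) c + psign (i * j) *s br b (br a c)"

context superspace
begin

definition hcomp :: "bit \<Rightarrow> 'a \<Rightarrow> 'a" where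
  "hcomp i a = (THE b. b \<in> G i \<and> a - b \<in> G (i + 1))"

text \<open>A \<open>k+1\<close>-linear map is a function on lists that vanishes on all lists of length other than
  \<open>k+1\<close>. In particular \<open>W (-1)\<close> consists of the functions supported on the empty list, i.e. it is
  a copy of \<open>A\<close>, with \<open>Y\<close> corresponding to \<open>Y []\<close>; and \<open>W k\<close> is zero for \<open>k < -1\<close>.
  With this encoding the direct sum of the \<open>W k\<close> is a space of functions on lists, the sum being
  the pointwise one.\<close>

definition W :: "int \<Rightarrow> ('a list \<Rightarrow> 'a) set" where
  "W k = {X.
     (\<forall>vs. int (length vs) \<noteq> k + 1 \<longrightarrow> X vs = 0) \<and>
     (\<forall>us ws. int (length us + 1 + length ws) = k + 1 \<longrightarrow>
        Vector_Spaces.linear scale scale (\<lambda>a. X (us @ a # ws))) \<and>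
     (\<forall>us ws i j. \<forall>a\<in>G i. \<forall>b\<in>G j.
        X (us @ a # b # ws) = psign (i * j) *s X (us @ b # a # ws))}"

definition has_parity :: "bit \<Rightarrow> ('a list \<Rightarrow> 'a) \<Rightarrow> bool" where
  "has_parity q X \<longleftrightarrow>
     (\<forall>vs js. list_all2 (\<lambda>v j. v \<in> G j) vs js \<longrightarrow> X vs \<in> G (q + sum_list js))"

text \<open>The parity \<open>q\<close> component of a multilinear map.\<close>

definition part :: "bit \<Rightarrow> ('a list \<Rightarrow> 'a) \<Rightarrow> 'a list \<Rightarrow> 'a" where
  "part q X vs =
     (\<Sum>js | length js = length vs. hcomp (q + sum_list js) (X (map2 hcomp js vs)))"

text \<open>The number of interchanges of odd entries in the permutation \<open>is\<close>, where \<open>js\<close> lists the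
  parities of the arguments.\<close>

definition odd_inversions :: "bit list \<Rightarrow> nat list \<Rightarrow> nat" where
  "odd_inversions js is =
     card {(r, s). r < s \<and> s < length is \<and> is ! r > is ! s \<and> js ! (is ! r) = 1 \<and> js ! (is ! s) = 1}"

text \<open>The box product on homogeneous arguments \<open>vs\<close> of parities \<open>js\<close>. The pairs of increasing
  sequences of indices are given by the set \<open>S\<close> of indices occurring in the first one. For \<open>X\<close> in
  \<open>W h\<close> and \<open>Y\<close> in \<open>W (k-h)\<close> the summand vanishes unless \<open>S\<close> has \<open>k-h+1\<close> elements and \<open>vs\<close> has
  length \<open>k+1\<close>, so letting \<open>S\<close> range over all subsets gives the bilinear extension of the
  usual formula to the direct sum of the \<open>W k\<close>.\<close>

definition box_hom ::
  "('a list \<Rightarrow> 'a) \<Rightarrow> ('a list \<Rightarrow> 'a) \<Rightarrow> bit list \<Rightarrow> 'a list \<Rightarrow> 'a" where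
  "box_hom X Y js vs =
     (\<Sum>S\<in>Pow {..<length vs}.
        let is = sorted_list_of_set S; is' = sorted_list_of_set ({..<length vs} - S)
        in (- 1) ^ odd_inversions js (is @ is') *s
             X (Y (map (\<lambda>i. vs ! i) is) # map (\<lambda>i. vs ! i) is'))"

text \<open>Since the sign depends on parities, arbitrary arguments are first split into their
  homogeneous components; this is the multilinear extension.\<close>

definition box :: "('a list \<Rightarrow> 'a) \<Rightarrow> ('a list \<Rightarrow> 'a) \<Rightarrow> 'a list \<Rightarrow> 'a" where
  "box X Y vs = (\<Sum>js | length js = length vs. box_hom X Y js (map2 hcomp js vs))"

text \<open>The bracket $[X,Y] = X \Box Y - (-1)^{p(X)p(Y)}\, Y \Box X$, extended bilinearly from
  homogeneous \<open>X\<close> and \<open>Y\<close>.\<close>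

definition W_bracket :: "('a list \<Rightarrow> 'a) \<Rightarrow> ('a list \<Rightarrow> 'a) \<Rightarrow> 'a list \<Rightarrow> 'a" where
  "W_bracket X Y vs = (\<Sum>p\<in>UNIV. \<Sum>q\<in>UNIV.
     box (part p X) (part q Y) vs - psign (p * q) *s box (part q Y) (part p X) vs)"

end

locale comm_assoc_superalgebra = superspace scale G
  for scale :: "'f::field_char_0 \<Rightarrow> 'a::ab_group_add \<Rightarrow> 'a" (infixr \<open>*s\<close> 75)
    and G :: "bit \<Rightarrow> 'a set" +
  fixes mul :: "'a \<Rightarrow> 'a \<Rightarrow> 'a" (infixl \<open>\<bullet>\<close> 70)
  assumes mul_linear_right: "Vector_Spaces.linear scale scale (\<lambda>b. a \<bullet> b)"
    and mul_linear_left: "Vector_Spaces.linear scale scale (\<lambda>a. a \<bullet> b)"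
    and mul_grading: "a \<in> G i \<Longrightarrow> b \<in> G j \<Longrightarrow> a \<bullet> b \<in> G (i + j)"
    and mul_assoc: "(a \<bullet> b) \<bullet> c = a \<bullet> (b \<bullet> c)"
    and mul_comm: "a \<in> G i \<Longrightarrow> b \<in> G j \<Longrightarrow> a \<bullet> b = psign (i * j) *s (b \<bullet> a)"
begin

definition Der :: "('a \<Rightarrow> 'a) set" where
  "Der = {D. Vector_Spaces.linear scale scale D \<and>
     (\<forall>i j. \<forall>a\<in>G i. \<forall>b\<in>G j. D (a \<bullet> b) = D a \<bullet> b + psign (i * j) *s (D b \<bullet> a))}"

function W_as :: "int \<Rightarrow> ('a list \<Rightarrow> 'a) set" where
  "W_as k =
     (if k \<le> -1 then W k
      else if k = 0 then {X \<in> W 0. (\<lambda>a. X [a]) \<in> Der}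
      else {X \<in> W k. \<forall>Y\<in>W (-1). W_bracket X Y \<in> W_as (k - 1)})"
  by pat_completeness auto
termination by (relation "measure (\<lambda>k. nat (k + 1))") auto

declare W_as.simps [simp del]

definition odd_poisson :: "('a \<Rightarrow> 'a \<Rightarrow> 'a) \<Rightarrow> bool" where
  "odd_poisson br \<longleftrightarrow>
     lie_superalgebra scale (parity_rev G) br \<and>
     (\<forall>i j. \<forall>a\<in>G i. \<forall>b\<in>G j. \<forall>c.
        br a (b \<bullet> c) = br a b \<bullet> c + psign ((i + 1) * j) *s (b \<bullet> br a c))"

text \<open>The bracket $[a,b] = (-1)^{p(a)+1} X(a,b)$, extended linearly from homogeneous \<open>a\<close>.\<close>

definition bracket_of :: "('a list \<Rightarrow> 'a) \<Rightarrow> 'a \<Rightarrow> 'a \<Rightarrow> 'a" where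
  "bracket_of X a b = (\<Sum>i\<in>UNIV. psign (i + 1) *s X [hcomp i a, b])"

end

end

theory Submission
  imports Defs
begin

text \<open>For homogeneous $a$ the bracket is $\pm X(a, b)$ with a sign depending only on $p(a)$, so
  passing from $X$ to the bracket is an involution on bilinear maps. Under it, supersymmetry and
  oddness of $X$ become skew-symmetry and evenness on $\Pi A$; since $[X, Y] = X(Y, \cdot)$ for
  $Y \in A$, membership in the prolongation says that every $X(a, \cdot)$ is a derivation, which is
  the Leibniz rule; and since $X$ is odd, $[X, X] = 2\, X \Box X$, whose vanishing at
  homogeneous $a$, $b$, $c$ is the Jacobi identity, up to an overall sign.\<close>

section \<open>Signs and sums indexed by parities\<close>

lemma psign_0 [simp]: "psign 0 = 1" and psign_1 [simp]: "psign 1 = - 1"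
  by (simp_all add: psign_def)

lemma bit_cases: "(i::bit) = 0 \<or> i = 1"
  by (cases i) auto

lemma UNIV_bit: "(UNIV :: bit set) = {0, 1}"
  using bit_cases by auto

lemma sum_bit: "(\<Sum>i\<in>UNIV. F i) = F (0::bit) + F 1"
  by (simp add: UNIV_bit)

lemma sum_length_0: "(\<Sum>js | length js = 0. F js) = F []"
  by simp

text \<open>Applied once per argument, this turns the sums over parity lists in \<open>part\<close>
  and \<open>box\<close> into iterated sums over single parities.\<close>

lemma sum_length_Suc:
  "(\<Sum>js | length (js :: bit list) = Suc n. F js) =
   (\<Sum>j\<in>UNIV. \<Sum>js | length js = n. F (j # js))"
proof -
  have *: "{js :: bit list. length js = Suc n} =
      (\<lambda>(j, js). j # js) ` (UNIV \<times> {js. length js = n})"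
    by (auto simp: length_Suc_conv)
  show ?thesis
    unfolding * by (subst sum.reindex)
      (auto simp: inj_on_def sum.cartesian_product case_prod_unfold)
qed

section \<open>Homogeneous components in a superspace\<close>

context superspace
begin

lemma linear_scale_iff: "Vector_Spaces.linear scale scale f \<longleftrightarrow>
    (\<forall>x y. f (x + y) = f x + f y) \<and> (\<forall>c x. f (c *s x) = c *s f x)"
  using vector_space_axioms by (simp add: Vector_Spaces.linear_iff)

lemma G_add: "a \<in> G i \<Longrightarrow> b \<in> G i \<Longrightarrow> a + b \<in> G i"
  and G_scale: "a \<in> G i \<Longrightarrow> c *s a \<in> G i"
  and G_zero [simp]: "0 \<in> G i"
  and G_minus: "a \<in> G i \<Longrightarrow> - a \<in> G i"
  and G_diff: "a \<in> G i \<Longrightarrow> b \<in> G i \<Longrightarrow> a - b \<in> G i"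
  using subspace_G subspace_add subspace_scale subspace_0 subspace_neg subspace_diff by metis+

lemma G_inter_eq_0: "a \<in> G i \<Longrightarrow> a \<in> G (i + 1) \<Longrightarrow> a = 0"
proof -
  assume "a \<in> G i" "a \<in> G (i + 1)"
  hence "a \<in> G 0 \<inter> G 1" using bit_cases[of i] by (elim disjE) simp_all
  thus "a = 0" using G_inter by simp
qed

text \<open>Two candidates for the component differ by an element of both \<open>G i\<close> and
  \<open>G (i + 1)\<close>, hence by zero. This gives a checkable criterion in place of the definite
  description.\<close>

lemma hcomp_eqI:
  assumes "b \<in> G i" "a - b \<in> G (i + 1)"
  shows "hcomp i a = b"
  unfolding hcomp_def
proof (rule the_equality)
  fix b' assume b': "b' \<in> G i \<and> a - b' \<in> G (i + 1)"
  have "b' - b \<in> G i" using assms b' G_diff by auto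
  moreover have "b' - b = (a - b) - (a - b')" by simp
  hence "b' - b \<in> G (i + 1)" using assms b' G_diff by metis
  ultimately show "b' = b" using G_inter_eq_0 by fastforce
qed (use assms in simp)

lemma hcomp_props: "hcomp i a \<in> G i \<and> a - hcomp i a \<in> G (i + 1)"
proof -
  obtain b c where bc: "b \<in> G 0" "c \<in> G 1" "a = b + c" using G_span by blast
  have "hcomp 0 a = b" "hcomp 1 a = c" by (rule hcomp_eqI; use bc in simp)+
  thus ?thesis using bc bit_cases[of i] by auto
qed

lemma hcomp_in [simp]: "hcomp i a \<in> G i"
  using hcomp_props by blast

lemma hcomp_same: "a \<in> G i \<Longrightarrow> hcomp i a = a"
  by (rule hcomp_eqI) auto

lemma hcomp_other: "a \<in> G i \<Longrightarrow> i \<noteq> j \<Longrightarrow> hcomp j a = 0"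
  using bit_cases[of i] bit_cases[of j] by (auto intro!: hcomp_eqI)

lemma hcomp_homogeneous: "a \<in> G i \<Longrightarrow> hcomp j a = (if j = i then a else 0)"
  using hcomp_same hcomp_other by auto

lemma hcomp_zero [simp]: "hcomp i 0 = 0"
  by (simp add: hcomp_same)

lemma hcomp_sum: "hcomp 0 a + hcomp 1 a = a"
proof -
  have "hcomp 1 a = a - hcomp 0 a"
    by (rule hcomp_eqI) (use hcomp_props[of 0 a] in auto)
  thus ?thesis by simp
qed

lemma hcomp_add: "hcomp i (a + b) = hcomp i a + hcomp i b"
  using hcomp_props[of i a] hcomp_props[of i b] G_add[of _ i] G_add[of "a - hcomp i a" "i+1" "b - hcomp i b"]
  by (intro hcomp_eqI) (auto simp: algebra_simps)

lemma hcomp_scale: "hcomp i (c *s a) = c *s hcomp i a"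
  using hcomp_props[of i a] G_scale[of _ i] G_scale[of "a - hcomp i a" "i+1" c]
  by (intro hcomp_eqI) (auto simp: scale_right_diff_distrib)

lemma linear_hcomp_sum:
  assumes "Vector_Spaces.linear scale scale f"
  shows "f (hcomp 0 a) + f (hcomp 1 a) = f a"
  using assms hcomp_sum[of a] unfolding linear_scale_iff by metis

lemma linear_eqI_homogeneous:
  assumes "Vector_Spaces.linear scale scale f" "Vector_Spaces.linear scale scale g"
    and "\<And>i a. a \<in> G i \<Longrightarrow> f a = g a"
  shows "f a = g a"
  using assms(3) linear_hcomp_sum[OF assms(1), of a] linear_hcomp_sum[OF assms(2), of a]
  by (metis hcomp_in)

section \<open>Bilinear maps and the sign twist in the first argument\<close>

definition bilin :: "('a \<Rightarrow> 'a \<Rightarrow> 'a) \<Rightarrow> bool" where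
  "bilin f \<longleftrightarrow> (\<forall>b. Vector_Spaces.linear scale scale (\<lambda>a. f a b)) \<and>
     (\<forall>a. Vector_Spaces.linear scale scale (f a))"

lemma bilinD:
  assumes "bilin f"
  shows "f (a + b) c = f a c + f b c" "f a (b + c) = f a b + f a c"
    "f (k *s a) b = k *s f a b" "f a (k *s b) = k *s f a b"
    "f 0 b = 0" "f a 0 = 0" "f (- a) b = - f a b" "f a (- b) = - f a b"
proof -
  show add: "f (a + b) c = f a c + f b c" "f a (b + c) = f a b + f a c"
    "f (k *s a) b = k *s f a b" "f a (k *s b) = k *s f a b" for a b c k
    using assms unfolding bilin_def linear_scale_iff by auto
  show z: "f 0 b = 0" "f a 0 = 0" using add(3)[of 0] add(4)[of _ 0] by force+
  show "f (- a) b = - f a b" "f a (- b) = - f a b"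
    using add(3)[of "-1"] add(4)[of _ "-1"] by force+
qed

text \<open>This is the formula of \<open>bracket_of\<close>, stated for a binary map instead of a
  function on lists, so that it can be iterated.\<close>

definition twist :: "('a \<Rightarrow> 'a \<Rightarrow> 'a) \<Rightarrow> 'a \<Rightarrow> 'a \<Rightarrow> 'a" where
  "twist f a b = (\<Sum>i\<in>UNIV. psign (i + 1) *s f (hcomp i a) b)"

lemma twist_eq: "twist f a b = f (hcomp 1 a) b - f (hcomp 0 a) b"
  by (simp add: twist_def sum_bit)

lemma twist_homogeneous: "bilin f \<Longrightarrow> a \<in> G i \<Longrightarrow> twist f a b = psign (i + 1) *s f a b"
  using bit_cases[of i] by (auto simp: twist_eq hcomp_homogeneous bilinD)

lemma bilin_twist: "bilin f \<Longrightarrow> bilin (twist f)"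
  unfolding bilin_def[of "twist f"] linear_scale_iff twist_eq
  by (auto simp: hcomp_add hcomp_scale bilinD scale_right_diff_distrib)

text \<open>On each homogeneous component of the first argument the twist multiplies by a sign,
  whose square is 1; additivity reassembles the components.\<close>

lemma twist_twist: assumes "bilin f" shows "twist (twist f) = f"
proof (intro ext)
  fix a b
  have "f (hcomp 0 a + hcomp 1 a) b = f (hcomp 0 a) b + f (hcomp 1 a) b"
    using assms by (simp add: bilinD)
  thus "twist (twist f) a b = f a b"
    using assms by (simp add: hcomp_sum twist_eq hcomp_homogeneous[OF hcomp_in] bilinD)
qed

section \<open>Lie superalgebra structures on the parity-reversed space\<close>

lemma superspace_parity_rev: "superspace scale (parity_rev G)"
proof unfold_locales
  show "subspace (parity_rev G i)" for i by (simp add: parity_rev_def subspace_G)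
  show "parity_rev G 0 \<inter> parity_rev G 1 = {0}" using G_inter by (auto simp: parity_rev_def)
  show "\<exists>b\<in>parity_rev G 0. \<exists>c\<in>parity_rev G 1. a = b + c" for a
    using G_span[of a] by (auto simp: parity_rev_def) (metis add.commute)
qed

text \<open>The conditions for the binary map to come from an odd element of
  \<open>W 1\<close>.\<close>

definition odd_symmetric :: "('a \<Rightarrow> 'a \<Rightarrow> 'a) \<Rightarrow> bool" where
  "odd_symmetric f \<longleftrightarrow> bilin f \<and>
    (\<forall>i j. \<forall>a\<in>G i. \<forall>b\<in>G j. f a b \<in> G (i + j + 1) \<and> f a b = psign (i * j) *s f b a)"

text \<open>The left-hand side is the box square of the map at homogeneous arguments, one term for
  each choice of the two arguments that enter first.\<close>

definition square_zero :: "('a \<Rightarrow> 'a \<Rightarrow> 'a) \<Rightarrow> bool" where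
  "square_zero f \<longleftrightarrow> (\<forall>i j l. \<forall>a\<in>G i. \<forall>b\<in>G j. \<forall>c\<in>G l.
     f (f a b) c + psign (j * l) *s f (f a c) b + psign (i * (j + l)) *s f (f b c) a = 0)"

text \<open>An element of \<open>G i\<close> has reversed parity \<open>i + 1\<close>, so every
  axiom is restated in the original grading with its parities shifted by 1.\<close>

lemma lie_superalgebra_parity_rev:
  "lie_superalgebra scale (parity_rev G) br \<longleftrightarrow> bilin br \<and>
    (\<forall>i j. \<forall>a\<in>G i. \<forall>b\<in>G j. br a b \<in> G (i + j + 1) \<and>
       br a b = - (psign ((i + 1) * (j + 1)) *s br b a)) \<and>
    (\<forall>i j l. \<forall>a\<in>G i. \<forall>b\<in>G j. \<forall>c\<in>G l.
       br a (br b c) = br (br a b) c + psign ((i + 1) * (j + 1)) *s br b (br a c))"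
  (is "?L \<longleftrightarrow> ?R")
proof
  have add1: "i + 1 + 1 = i" for i :: bit by (simp add: add.assoc)
  have mem: "a \<in> parity_rev G (i + 1) \<longleftrightarrow> a \<in> G i" for a i
    by (simp add: parity_rev_def add1)
  have par: "i + 1 + (j + 1) = i + j + 1 + 1" for i j :: bit
    by (simp only: ac_simps)
  {
    assume ?L
    then interpret L: lie_superalgebra scale "parity_rev G" br .
    \<comment> \<open>Instantiating each axiom at parities of the form \<open>_ + 1\<close> turns
      membership in \<open>parity_rev G\<close> into membership in \<open>G\<close>, since 1 + 1 =
      0.\<close>
    show ?R
      unfolding bilin_def
      using L.br_linear_left L.br_linear_right
        L.br_grading[of _ "_ + 1" _ "_ + 1", unfolded mem par]
        L.br_skew[of _ "_ + 1" _ "_ + 1", unfolded mem]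
        L.br_jacobi[of _ "_ + 1" _ "_ + 1" _ "_ + 1", unfolded mem]
      by blast
  }
  {
    assume R: ?R
    have par': "i + 1 + (j + 1) + 1 = i + j + 1" for i j :: bit
      by (simp only: par add1)
    show ?L
      unfolding lie_superalgebra_def lie_superalgebra_axioms_def
    proof (intro conjI allI impI superspace_parity_rev)
      fix a b i j assume "a \<in> parity_rev G i" "b \<in> parity_rev G j"
      hence ab: "a \<in> G (i + 1)" "b \<in> G (j + 1)" by (simp_all add: parity_rev_def)
      have "br a b \<in> G (i + 1 + (j + 1) + 1)" using R ab by blast
      thus "br a b \<in> parity_rev G (i + j)" unfolding parity_rev_def par' .
      have "br a b = - (psign ((i + 1 + 1) * (j + 1 + 1)) *s br b a)" using R ab by blast
      thus "br a b = - (psign (i * j) *s br b a)" unfolding add1 .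
      fix c l assume "c \<in> parity_rev G l"
      hence c: "c \<in> G (l + 1)" by (simp add: parity_rev_def)
      have "br a (br b c) = br (br a b) c + psign ((i + 1 + 1) * (j + 1 + 1)) *s br b (br a c)"
        using R ab c by blast
      thus "br a (br b c) = br (br a b) c + psign (i * j) *s br b (br a c)" unfolding add1 .
    qed (use R in \<open>simp_all add: bilin_def\<close>)
  }
qed

text \<open>Grading and skew-symmetry of \<open>twist f\<close> match oddness and supersymmetry of
  \<open>f\<close> for each homogeneous pair. Given these, the Jacobi identity differs from the
  vanishing of the box square only by moving terms and by an overall sign.\<close>

lemma lie_superalgebra_twist:
  assumes "bilin f"
  shows "lie_superalgebra scale (parity_rev G) (twist f) \<longleftrightarrow> odd_symmetric f \<and> square_zero f"
proof -
  \<comment> \<open>A sign is 1 or -1, and each \<open>G q\<close> is closed under negation.\<close>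
  have mem: "psign p *s x \<in> G q \<longleftrightarrow> x \<in> G q" for p q x
    using bit_cases[of p] G_minus[of x q] G_minus[of "- x" q] by auto
  have sym: "twist f a b \<in> G (i + j + 1) \<and>
       twist f a b = - (psign ((i + 1) * (j + 1)) *s twist f b a) \<longleftrightarrow>
       f a b \<in> G (i + j + 1) \<and> f a b = psign (i * j) *s f b a"
    if "a \<in> G i" "b \<in> G j" for a b i j
  proof -
    have "twist f a b \<in> G (i + j + 1) \<longleftrightarrow> f a b \<in> G (i + j + 1)"
      unfolding twist_homogeneous[OF assms that(1)] mem ..
    moreover have "twist f a b = - (psign ((i + 1) * (j + 1)) *s twist f b a) \<longleftrightarrow>
        f a b = psign (i * j) *s f b a"
      unfolding twist_homogeneous[OF assms that(1)] twist_homogeneous[OF assms that(2)]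
      using bit_cases[of i] bit_cases[of j] by (elim disjE) auto
    ultimately show ?thesis by blast
  qed
  have sym: "(\<forall>i j. \<forall>a\<in>G i. \<forall>b\<in>G j. twist f a b \<in> G (i + j + 1) \<and>
       twist f a b = - (psign ((i + 1) * (j + 1)) *s twist f b a)) \<longleftrightarrow> odd_symmetric f"
    unfolding odd_symmetric_def using assms sym by meson
  have jac: "twist f a (twist f b c) = twist f (twist f a b) c +
        psign ((i + 1) * (j + 1)) *s twist f b (twist f a c) \<longleftrightarrow>
      f (f a b) c + psign (j * l) *s f (f a c) b + psign (i * (j + l)) *s f (f b c) a = 0"
    if f: "odd_symmetric f" and a: "a \<in> G i" and b: "b \<in> G j" and c: "c \<in> G l" for a b c i j l
  proof -
    have par: "f x y \<in> G (p + q + 1)" and sw: "f x y = psign (p * q) *s f y x"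
      if "x \<in> G p" "y \<in> G q" for x y p q
      using f that unfolding odd_symmetric_def by blast+
    note ab = par[OF a b] and ac = par[OF a c] and bc = par[OF b c]
    \<comment> \<open>Supersymmetry moves \<open>f b c\<close>, of parity \<open>j + l + 1\<close>,
      to the first slot; the other two signs come from the two twists.\<close>
    have 1: "twist f a (twist f b c) =
        psign (i + 1) *s psign (j + 1) *s psign (i * (j + l + 1)) *s f (f b c) a"
      using assms a b sw[OF a bc] by (simp add: twist_homogeneous bilinD)
    \<comment> \<open>The outer twist sees \<open>f a b\<close>, of parity \<open>i + j + 1\<close>,
      and so contributes \<open>psign (i + j)\<close>.\<close>
    have 2: "twist f (twist f a b) c = psign (i + 1) *s psign (i + j) *s f (f a b) c"
      using assms a twist_homogeneous[OF assms ab, of c] bilin_twist[OF assms]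
      by (simp add: twist_homogeneous bilinD add.assoc)
    have 3: "twist f b (twist f a c) =
        psign (i + 1) *s psign (j + 1) *s psign (j * (i + l + 1)) *s f (f a c) b"
      using assms a b sw[OF b ac] by (simp add: twist_homogeneous bilinD)
    \<comment> \<open>The common factor is \<open>psign j\<close>: the signs in the term with
      \<open>f (f a b) c\<close> multiply to \<open>psign (j + 1)\<close>, and the subtraction
      reverses this. The eight parity cases confirm the other two terms.\<close>
    have "twist f a (twist f b c) - (twist f (twist f a b) c +
        psign ((i + 1) * (j + 1)) *s twist f b (twist f a c)) =
        psign j *s (f (f a b) c + psign (j * l) *s f (f a c) b + psign (i * (j + l)) *s f (f b c) a)"
      unfolding 1 2 3
      using bit_cases[of i] bit_cases[of j] bit_cases[of l]
      by (elim disjE) (simp_all)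
    moreover have "psign j *s x = 0 \<longleftrightarrow> x = 0" for x :: 'a
      using bit_cases[of j] by auto
    ultimately show ?thesis by (metis right_minus_eq)
  qed
  have "(\<forall>i j l. \<forall>a\<in>G i. \<forall>b\<in>G j. \<forall>c\<in>G l. twist f a (twist f b c) =
      twist f (twist f a b) c + psign ((i + 1) * (j + 1)) *s twist f b (twist f a c)) \<longleftrightarrow>
      square_zero f" if "odd_symmetric f"
    unfolding square_zero_def by (intro all_cong1 ball_cong refl jac[OF that])
  thus ?thesis
    unfolding lie_superalgebra_parity_rev sym using bilin_twist[OF assms] by blast
qed


section \<open>Low degrees: signs of permutations of three indices, the components
  \<open>W 0\<close> and \<open>W 1\<close>, and odd elements of \<open>W 1\<close>\<close>

lemma odd_inversions_3:
  "odd_inversions js [x, y, z] =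
     of_bool (x > y \<and> js ! x = 1 \<and> js ! y = 1) + of_bool (x > z \<and> js ! x = 1 \<and> js ! z = 1) +
     of_bool (y > z \<and> js ! y = 1 \<and> js ! z = 1)"
proof -
  let ?P = "\<lambda>u v. u > v \<and> js ! u = 1 \<and> js ! v = 1"
  have "{(r, s). r < s \<and> s < length [x, y, z] \<and> [x, y, z] ! r > [x, y, z] ! s \<and>
        js ! ([x, y, z] ! r) = 1 \<and> js ! ([x, y, z] ! s) = 1} =
      (if ?P x y then {(0, 1)} else {}) \<union> (if ?P x z then {(0, 2)} else {}) \<union>
      (if ?P y z then {(1, 2)} else {})" (is "?A = ?B")
  proof (intro set_eqI)
    fix rs :: "nat \<times> nat"
    obtain r s where [simp]: "rs = (r, s)" by force
    show "rs \<in> ?A \<longleftrightarrow> rs \<in> ?B"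
    proof (cases "r < s \<and> s < 3")
      case True
      hence "r = 0 \<and> s = 1 \<or> r = 0 \<and> s = 2 \<or> r = 1 \<and> s = 2" by auto
      thus ?thesis by (elim disjE) auto
    next
      case False
      have "?B \<subseteq> {(0, 1), (0, 2), (1, 2)}" by simp
      hence "rs \<notin> ?B" using False by auto
      moreover have "rs \<notin> ?A" using False by (auto simp: numeral_3_eq_3)
      ultimately show ?thesis by blast
    qed
  qed
  thus ?thesis unfolding odd_inversions_def by (simp add: card_insert_if)
qed

lemma W_zero_arg:
  assumes "X \<in> W k"
  shows "X (us @ 0 # ws) = 0"
proof (cases "int (length us + 1 + length ws) = k + 1")
  case True
  hence "Vector_Spaces.linear scale scale (\<lambda>a. X (us @ a # ws))"
    using assms unfolding W_def by blast
  hence "X (us @ (0 *s 0) # ws) = 0 *s X (us @ 0 # ws)" unfolding linear_scale_iff by blast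
  thus ?thesis by simp
qed (use assms in \<open>auto simp: W_def\<close>)

lemma W_0_iff:
  "X \<in> W 0 \<longleftrightarrow> (\<forall>vs. length vs \<noteq> 1 \<longrightarrow> X vs = 0) \<and> Vector_Spaces.linear scale scale (\<lambda>a. X [a])"
  (is "_ \<longleftrightarrow> ?S \<and> ?B")
proof
  assume X: "X \<in> W 0"
  have "Vector_Spaces.linear scale scale (\<lambda>a. X ([] @ a # []))"
    by (rule X[unfolded W_def mem_Collect_eq, THEN conjunct2, THEN conjunct1, rule_format]) simp
  thus "?S \<and> ?B" using X by (auto simp: W_def)
next
  assume R: "?S \<and> ?B"
  \<comment> \<open>Supersymmetry is vacuous in \<open>W 0\<close>: a list with two adjacent entries
    is too long, so both sides vanish.\<close>
  have "X (us @ a # b # ws) = 0" for us a b ws using R by simp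
  moreover have "us = [] \<and> ws = []" if "int (length us + 1 + length ws) = 0 + 1" for us ws :: "'a list"
    using that by (cases us; cases ws) auto
  ultimately show "X \<in> W 0" using R by (fastforce simp: W_def)
qed

text \<open>A list of length 2 has two slots and one adjacent pair, so multilinearity is bilinearity
  and supersymmetry is a single exchange rule; at all other lengths \<open>X\<close> is
  zero.\<close>

lemma W_1_iff:
  "X \<in> W 1 \<longleftrightarrow> (\<forall>vs. length vs \<noteq> 2 \<longrightarrow> X vs = 0) \<and> bilin (\<lambda>a b. X [a, b]) \<and>
     (\<forall>i j. \<forall>a\<in>G i. \<forall>b\<in>G j. X [a, b] = psign (i * j) *s X [b, a])" (is "?L \<longleftrightarrow> ?S \<and> ?B \<and> ?C")
proof -
  have S: "(\<forall>vs. int (length vs) \<noteq> 1 + 1 \<longrightarrow> X vs = 0) \<longleftrightarrow> ?S"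
    by (intro all_cong1) auto
  have B: "(\<forall>us ws. int (length us + 1 + length ws) = 1 + 1 \<longrightarrow>
      Vector_Spaces.linear scale scale (\<lambda>a. X (us @ a # ws))) \<longleftrightarrow> ?B" (is "?B' \<longleftrightarrow> _")
  proof
    assume B: ?B'
    show ?B unfolding bilin_def using B[rule_format, of "[]" "[_]"] B[rule_format, of "[_]" "[]"] by simp
  next
    assume B: ?B
    show ?B'
    proof (intro allI impI)
      fix us ws :: "'a list" assume "int (length us + 1 + length ws) = 1 + 1"
      hence "(\<exists>u. us = [u]) \<and> ws = [] \<or> us = [] \<and> (\<exists>w. ws = [w])"
        by (cases us; cases ws) auto
      thus "Vector_Spaces.linear scale scale (\<lambda>a. X (us @ a # ws))"
        using B unfolding bilin_def by auto
    qed
  qed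
  have C: "(\<forall>us ws i j. \<forall>a\<in>G i. \<forall>b\<in>G j.
      X (us @ a # b # ws) = psign (i * j) *s X (us @ b # a # ws)) \<longleftrightarrow> ?C" (is "?C' \<longleftrightarrow> _") if S: ?S
  proof
    assume C: ?C'
    show ?C using C[THEN spec[of _ "[]"], THEN spec[of _ "[]"]] by (simp only: append_Nil)
  next
    assume C: ?C
    show ?C'
    proof (intro allI ballI)
      fix us ws i j a b assume ab: "a \<in> G i" "b \<in> G j"
      show "X (us @ a # b # ws) = psign (i * j) *s X (us @ b # a # ws)"
      proof (cases "us = [] \<and> ws = []")
        case True
        thus ?thesis using C[rule_format, OF ab] by simp
      next
        case False
        hence "length (us @ x # y # ws) \<noteq> 2" for x y by auto
        hence "X (us @ x # y # ws) = 0" for x y using S by blast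
        thus ?thesis by simp
      qed
    qed
  qed
  show ?thesis unfolding W_def mem_Collect_eq S B using C by blast
qed

lemma has_parity_1_iff:
  assumes "\<forall>vs. length vs \<noteq> 2 \<longrightarrow> X vs = 0"
  shows "has_parity 1 X \<longleftrightarrow> (\<forall>i j. \<forall>a\<in>G i. \<forall>b\<in>G j. X [a, b] \<in> G (i + j + 1))" (is "_ \<longleftrightarrow> ?R")
proof
  assume L: "has_parity 1 X"
  show ?R
  proof (intro allI ballI)
    fix i j a b assume "a \<in> G i" "b \<in> G j"
    hence "X [a, b] \<in> G (1 + sum_list [i, j])"
      using L[unfolded has_parity_def, rule_format, of "[a, b]" "[i, j]"] by simp
    thus "X [a, b] \<in> G (i + j + 1)" by (simp add: ac_simps)
  qed
next
  assume R: ?R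
  show "has_parity 1 X"
    unfolding has_parity_def
  proof (intro allI impI)
    fix vs js assume vj: "list_all2 (\<lambda>v j. v \<in> G j) vs js"
    show "X vs \<in> G (1 + sum_list js)"
    proof (cases "length vs = 2")
      case True
      then obtain a b where "vs = [a, b]" by (auto simp: length_Suc_conv numeral_2_eq_2)
      moreover from this vj obtain i j where "js = [i, j]" "a \<in> G i" "b \<in> G j"
        by (auto simp: list_all2_Cons1)
      ultimately show ?thesis using R[rule_format, of a i b j] by (simp add: ac_simps)
    qed (use assms in simp)
  qed
qed

text \<open>The working form of being an odd element of \<open>W 1\<close>: everything is expressed
  through the binary part, to which the results on \<open>twist\<close> apply.\<close>

definition odd_W1 :: "('a list \<Rightarrow> 'a) \<Rightarrow> bool" where
  "odd_W1 X \<longleftrightarrow> (\<forall>vs. length vs \<noteq> 2 \<longrightarrow> X vs = 0) \<and> odd_symmetric (\<lambda>a b. X [a, b])"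

lemma odd_W1_iff: "odd_W1 X \<longleftrightarrow> X \<in> W 1 \<and> has_parity 1 X"
  unfolding W_1_iff odd_W1_def odd_symmetric_def using has_parity_1_iff[of X] by blast

lemma odd_W1D:
  assumes "odd_W1 X"
  shows "length vs \<noteq> 2 \<Longrightarrow> X vs = 0" "bilin (\<lambda>a b. X [a, b])" "X (0 # ws) = 0"
    "a \<in> G i \<Longrightarrow> b \<in> G j \<Longrightarrow> X [a, b] \<in> G (i + j + 1)"
proof -
  show "length vs \<noteq> 2 \<Longrightarrow> X vs = 0" "bilin (\<lambda>a b. X [a, b])"
    "a \<in> G i \<Longrightarrow> b \<in> G j \<Longrightarrow> X [a, b] \<in> G (i + j + 1)"
    using assms unfolding odd_W1_def odd_symmetric_def by blast+
  show "X (0 # ws) = 0"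
    using assms W_zero_arg[of X 1 "[]" ws] by (simp add: odd_W1_iff)
qed

text \<open>At arguments of parities \<open>j\<close> and \<open>k\<close> the value lies in
  \<open>G (j + k + 1)\<close>, so projecting it to parity \<open>q + (j + k)\<close> is the
  identity for \<open>q = 1\<close> and zero otherwise; bilinearity then sums the pieces.\<close>

lemma part_odd_W1:
  assumes "odd_W1 X"
  shows "part q X vs = (if q = 1 then X vs else 0)"
proof (cases "length vs = 2")
  case False
  thus ?thesis using assms by (auto simp: part_def odd_W1D intro!: sum.neutral)
next
  case True
  then obtain u v where vs: "vs = [u, v]" by (auto simp: length_Suc_conv numeral_2_eq_2)
  let ?f = "\<lambda>a b. X [a, b]"
  have h: "hcomp (q + (j + k)) (X [hcomp j u, hcomp k v]) =
      (if q = 1 then X [hcomp j u, hcomp k v] else 0)" for j k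
  proof -
    have "q + (j + k) = j + k + 1 \<longleftrightarrow> q = 1" by (simp add: ac_simps)
    thus ?thesis by (simp add: hcomp_homogeneous[OF odd_W1D(4)[OF assms hcomp_in hcomp_in]])
  qed
  have b: "X [a, hcomp 0 v] + X [a, hcomp 1 v] = X [a, v]"
    "X [hcomp 0 u, b] + X [hcomp 1 u, b] = X [u, b]" for a b
    using linear_hcomp_sum[of "?f a" v] linear_hcomp_sum[of "\<lambda>a. ?f a b" u]
      odd_W1D(2)[OF assms] unfolding bilin_def by blast+
  have "part q X vs = (\<Sum>j\<in>UNIV. \<Sum>k\<in>UNIV. hcomp (q + (j + k)) (X [hcomp j u, hcomp k v]))"
    unfolding part_def vs by (simp add: sum_length_Suc sum_length_0 del: length_0_conv)
  also have "\<dots> = (if q = 1 then X vs else 0)"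
    unfolding h sum_bit vs by (simp add: b)
  finally show ?thesis .
qed

section \<open>Brackets of an odd element of \<open>W 1\<close> with itself and with elements of
  \<open>A\<close>\<close>

lemma box_zero_left: "box (\<lambda>_. 0) Y vs = 0"
  by (auto simp: box_def box_hom_def Let_def intro!: sum.neutral)

lemma box_zero_right: "odd_W1 X \<Longrightarrow> box X (\<lambda>_. 0) vs = 0"
  by (auto simp: box_def box_hom_def Let_def odd_W1D intro!: sum.neutral)

text \<open>Only the odd parts survive, and the sign for two odd elements is -1, so the difference
  in the bracket becomes a sum.\<close>

lemma W_bracket_self:
  assumes "odd_W1 X"
  shows "W_bracket X X vs = box X X vs + box X X vs"
proof -
  have "part 0 X = (\<lambda>_. 0)" "part 1 X = X" using part_odd_W1[OF assms] by auto
  thus ?thesis by (simp add: W_bracket_def sum_bit box_zero_left box_zero_right assms)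
qed

lemma part_W_minus_1:
  assumes "Y \<in> W (- 1)"
  shows "part q Y vs = (if vs = [] then hcomp q (Y []) else 0)"
proof (cases "vs = []")
  case False
  hence "Y (map2 hcomp js vs) = 0" if "length js = length vs" for js
  proof -
    have "int (length (map2 hcomp js vs)) \<noteq> - 1 + 1" using that False by simp
    thus ?thesis using assms unfolding W_def by blast
  qed
  thus ?thesis using False by (auto simp: part_def intro!: sum.neutral)
qed (simp add: part_def)

lemma box_W_minus_1_left:
  assumes "\<And>vs. vs \<noteq> [] \<Longrightarrow> Z vs = 0"
  shows "box Z X vs = 0"
  using assms by (simp add: box_def box_hom_def Let_def)

text \<open>As \<open>Z\<close> lives on the empty list, only the empty \<open>S\<close>
  contributes; the remaining indices stay in order, so the sign is 1.\<close>

lemma box_W_minus_1_right: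
  assumes "odd_W1 X" "\<And>vs. vs \<noteq> [] \<Longrightarrow> Z vs = 0"
  shows "box X Z vs = X (Z [] # vs)"
proof (cases "length vs = 1")
  case False
  have "box_hom X Z js ws = 0" if len: "length ws = length vs" for js ws
    unfolding box_hom_def Let_def
  proof (intro sum.neutral ballI)
    fix S assume "S \<in> Pow {..<length ws}"
    show "(- 1) ^ odd_inversions js (sorted_list_of_set S @ sorted_list_of_set ({..<length ws} - S)) *s
        X (Z (map ((!) ws) (sorted_list_of_set S)) #
           map ((!) ws) (sorted_list_of_set ({..<length ws} - S))) = 0"
    \<comment> \<open>For empty \<open>S\<close>, \<open>X\<close> receives a list of length other
      than 2; for nonempty \<open>S\<close>, \<open>Z\<close> vanishes and \<open>X\<close> receives
      a zero argument.\<close>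
    proof (cases "S = {}")
      case True
      thus ?thesis using odd_W1D(1)[OF assms(1)] False len by simp
    next
      case False
      hence "sorted_list_of_set S \<noteq> []"
        using \<open>S \<in> Pow {..<length ws}\<close> finite_subset[of S "{..<length ws}"] by auto
      thus ?thesis using assms by (simp add: odd_W1D)
    qed
  qed
  thus ?thesis using False odd_W1D(1)[OF assms(1), of "Z [] # vs"] by (simp add: box_def)
next
  case True
  then obtain v where vs: "vs = [v]" by (auto simp: length_Suc_conv)
  have "odd_inversions js [0] = 0" for js
    unfolding odd_inversions_def by (rule card_eq_0_iff[THEN iffD2], rule disjI1) auto
  hence "box_hom X Z [j] [w] = X [Z [], w]" for j w
    using assms by (simp add: box_hom_def Pow_insert lessThan_Suc odd_W1D)
  hence "box X Z vs = X [Z [], hcomp 0 v] + X [Z [], hcomp 1 v]"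
    unfolding box_def vs by (simp add: sum_length_Suc sum_length_0 sum_bit del: length_0_conv)
  also have "\<dots> = X (Z [] # vs)"
    using linear_hcomp_sum[of "\<lambda>b. X [Z [], b]"] odd_W1D(2)[OF assms(1)] vs by (simp add: bilin_def)
  finally show ?thesis .
qed

text \<open>The terms with \<open>Y\<close> on the left vanish because \<open>Y\<close> would be
  applied to a nonempty list; the two parity components of \<open>Y []\<close> recombine by
  linearity.\<close>

lemma W_bracket_W_minus_1:
  assumes "odd_W1 X" "Y \<in> W (- 1)"
  shows "W_bracket X Y vs = X (Y [] # vs)"
proof -
  have p: "part 0 X = (\<lambda>_. 0)" "part 1 X = X" using part_odd_W1[OF assms(1)] by auto
  note q = part_W_minus_1[OF assms(2)]
  have r: "box X (part q Y) vs = X (hcomp q (Y []) # vs)" "box (part q Y) Z vs = 0" for q Z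
    using box_W_minus_1_right[OF assms(1), of "part q Y"] box_W_minus_1_left[of "part q Y"] q by simp_all
  have "W_bracket X Y vs = X (hcomp 0 (Y []) # vs) + X (hcomp 1 (Y []) # vs)"
    by (simp add: W_bracket_def sum_bit p r box_zero_left)
  also have "\<dots> = X (Y [] # vs)"
  proof (cases "length vs = 1")
    case True
    then obtain v where "vs = [v]" by (auto simp: length_Suc_conv)
    thus ?thesis
      using linear_hcomp_sum[of "\<lambda>a. X [a, v]"] odd_W1D(2)[OF assms(1)] by (simp add: bilin_def)
  qed (simp add: odd_W1D[OF assms(1)])
  finally show ?thesis .
qed

section \<open>The square of an odd element of \<open>W 1\<close>\<close>

lemma box_self_summand_eq_0:
  assumes "odd_W1 X" "length vs \<noteq> 3 \<or> card S \<noteq> 2" "S \<subseteq> {..<length vs}"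
  shows "X (X (map ((!) vs) (sorted_list_of_set S)) #
    map ((!) vs) (sorted_list_of_set ({..<length vs} - S))) = 0"
proof -
  have fin: "finite S" using assms(3) finite_subset by blast
  hence c: "card ({..<length vs} - S) = length vs - card S"
    using assms(3) by (simp add: card_Diff_subset)
  have le: "card S \<le> length vs" using assms(3) card_mono[of "{..<length vs}" S] by simp
  show ?thesis
  proof (cases "card S = 2")
    case True
    hence "Suc (length vs - card S) \<noteq> 2" using assms(2) le by auto
    thus ?thesis by (intro odd_W1D(1)[OF assms(1)]) (simp add: c)
  next
    case False
    hence "X (map ((!) vs) (sorted_list_of_set S)) = 0"
      by (intro odd_W1D(1)[OF assms(1)]) simp
    thus ?thesis by (simp add: odd_W1D(3)[OF assms(1)])
  qed
qed

text \<open>Only the three two-element sets \<open>S\<close> contribute. They give the index orders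
  0,1,2 and 0,2,1 and 1,2,0: the second interchanges \<open>b\<close> and \<open>c\<close>, the
  third moves \<open>a\<close> past both, whence the signs.\<close>

lemma box_hom_self_3:
  assumes "odd_W1 X"
  shows "box_hom X X [i, j, l] [a, b, c] =
    X [X [a, b], c] + psign (j * l) *s X [X [a, c], b] + psign (i * (j + l)) *s X [X [b, c], a]"
proof -
  let ?T = "\<lambda>S. (- 1) ^ odd_inversions [i, j, l]
      (sorted_list_of_set S @ sorted_list_of_set ({..<length [a, b, c]} - S)) *s
      X (X (map ((!) [a, b, c]) (sorted_list_of_set S)) #
         map ((!) [a, b, c]) (sorted_list_of_set ({..<length [a, b, c]} - S)))"
  have 3: "{..<length [a, b, c]} = {0, 1, 2}" by auto
  have "box_hom X X [i, j, l] [a, b, c] = sum ?T (Pow {..<length [a, b, c]})"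
    by (simp add: box_hom_def Let_def)
  also have "\<dots> = sum ?T {{0, 1}, {0, 2}, {1, 2}}"
  proof (intro sum.mono_neutral_right ballI)
    fix S assume S: "S \<in> Pow {..<length [a, b, c]} - {{0, 1}, {0, 2}, {1, 2}}"
    have "card S \<noteq> 2"
    proof
      assume "card S = 2"
      then obtain x y where xy: "S = {x, y}" "x \<noteq> y" by (auto simp: card_2_iff)
      have "x \<in> {0, 1, 2}" "y \<in> {0, 1, 2}" using S xy unfolding 3 by auto
      thus False using S xy by (auto simp: insert_commute)
    qed
    thus "?T S = 0" using S box_self_summand_eq_0[OF assms, of "[a, b, c]" S] by simp
  qed (auto simp: 3)
  also have "\<dots> = ?T {0, 1} + ?T {0, 2} + ?T {1, 2}"
    by (simp add: doubleton_eq_iff add.assoc)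
  also have "?T {0, 1} = X [X [a, b], c]"
  proof -
    have "{0, 1, 2} - {0, 1} = {2 :: nat}" by auto
    thus ?thesis unfolding 3 by (simp add: odd_inversions_3)
  qed
  also have "?T {0, 2} = psign (j * l) *s X [X [a, c], b]"
  proof -
    have "{0, 1, 2} - {0, 2} = {1 :: nat}" by auto
    thus ?thesis unfolding 3 using bit_cases[of j] bit_cases[of l]
      by (auto simp: odd_inversions_3)
  qed
  also have "?T {1, 2} = psign (i * (j + l)) *s X [X [b, c], a]"
  proof -
    have "{0, 1, 2} - {1, 2} = {0 :: nat}" by auto
    thus ?thesis unfolding 3 using bit_cases[of i] bit_cases[of j] bit_cases[of l]
      by (auto simp: odd_inversions_3)
  qed
  finally show ?thesis .
qed

text \<open>The bracket is twice the box square, which is supported on three arguments and is the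
  sum of its values at their homogeneous components.\<close>

lemma W_bracket_self_eq_0_iff:
  assumes "odd_W1 X"
  shows "W_bracket X X = (\<lambda>_. 0) \<longleftrightarrow> square_zero (\<lambda>a b. X [a, b])"
proof -
  let ?T = "\<lambda>i j l a b c. box_hom X X [i, j, l] [a, b, c]"
  have double: "x + x = 0 \<longleftrightarrow> x = 0" for x :: 'a
  proof -
    \<comment> \<open>In characteristic 0 the scalar \<open>1 + 1\<close> is nonzero.\<close>
    have "x + x = (1 + 1) *s x" by (simp only: scale_left_distrib scale_one)
    thus ?thesis by simp
  qed
  have box3: "box X X [a, b, c] =
      (\<Sum>i\<in>UNIV. \<Sum>j\<in>UNIV. \<Sum>l\<in>UNIV. ?T i j l (hcomp i a) (hcomp j b) (hcomp l c))" for a b c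
    by (simp add: box_def sum_length_Suc sum_length_0 del: length_0_conv)
  have zero: "?T i j l 0 b c = 0" "?T i j l a 0 c = 0" "?T i j l a b 0 = 0" for i j l a b c
    using bilinD(5,6)[OF odd_W1D(2)[OF assms]] by (simp_all add: box_hom_self_3[OF assms])
  \<comment> \<open>Of the eight parity triples only the actual one survives; each other summand has
    a zero argument.\<close>
  have hom: "box X X [a, b, c] = ?T i j l a b c" if "a \<in> G i" "b \<in> G j" "c \<in> G l" for a b c i j l
    unfolding box3 hcomp_homogeneous[OF that(1)] hcomp_homogeneous[OF that(2)] hcomp_homogeneous[OF that(3)]
    using bit_cases[of i] bit_cases[of j] bit_cases[of l]
    by (elim disjE) (simp_all add: sum_bit zero)
  have "W_bracket X X = (\<lambda>_. 0) \<longleftrightarrow> (\<forall>vs. box X X vs = 0)"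
    by (simp add: fun_eq_iff W_bracket_self[OF assms] double)
  also have "\<dots> \<longleftrightarrow> (\<forall>i j l. \<forall>a\<in>G i. \<forall>b\<in>G j. \<forall>c\<in>G l. ?T i j l a b c = 0)" (is "_ \<longleftrightarrow> ?R")
  proof
    assume R: ?R
    show "\<forall>vs. box X X vs = 0"
    proof
      fix vs :: "'a list"
      show "box X X vs = 0"
      proof (cases "length vs = 3")
        case True
        then obtain a b c where vs: "vs = [a, b, c]" by (auto simp: length_Suc_conv numeral_3_eq_3)
        show ?thesis unfolding vs box3 by (intro sum.neutral ballI R[rule_format] hcomp_in)
      next
        case False
        hence "box_hom X X js ws = 0" if "length ws = length vs" for js ws
        proof -
          have "length ws \<noteq> 3" using False that by simp
          from box_self_summand_eq_0[OF assms disjI1[OF this]] show ?thesis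
            unfolding box_hom_def Let_def by (intro sum.neutral) simp
        qed
        thus ?thesis unfolding box_def by (intro sum.neutral) auto
      qed
    qed
  qed (metis hom)
  also have "\<dots> \<longleftrightarrow> square_zero (\<lambda>a b. X [a, b])"
    by (simp add: square_zero_def box_hom_self_3[OF assms])
  finally show ?thesis .
qed

end

section \<open>Derivations, the Leibniz rule and the bijection\<close>

context comm_assoc_superalgebra
begin

text \<open>Bracketing with \<open>Y\<close> in \<open>W (-1)\<close> fixes the first argument at
  \<open>Y []\<close>, and every \<open>a\<close> arises as such a value.\<close>

lemma W_as_1_iff:
  assumes "odd_W1 X"
  shows "X \<in> W_as 1 \<longleftrightarrow> (\<forall>a. (\<lambda>b. X [a, b]) \<in> Der)"
proof -
  have as0: "W_bracket X Y \<in> W_as 0 \<longleftrightarrow> (\<lambda>b. X [Y [], b]) \<in> Der" if "Y \<in> W (- 1)" for Y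
  proof -
    have Y: "W_bracket X Y = (\<lambda>vs. X (Y [] # vs))"
      using W_bracket_W_minus_1[OF assms that] by blast
    have "W_bracket X Y \<in> W 0"
      unfolding Y W_0_iff using odd_W1D(1)[OF assms] odd_W1D(2)[OF assms] by (simp add: bilin_def)
    thus ?thesis by (subst W_as.simps) (simp add: Y)
  qed
  have ex: "\<exists>Y\<in>W (- 1). Y [] = a" for a
    by (intro bexI[of _ "\<lambda>vs. if vs = [] then a else 0"]) (auto simp: W_def)
  have "X \<in> W_as 1 \<longleftrightarrow> (\<forall>Y\<in>W (- 1). W_bracket X Y \<in> W_as 0)"
    using assms unfolding odd_W1_iff by (subst W_as.simps) simp
  also have "\<dots> \<longleftrightarrow> (\<forall>a. (\<lambda>b. X [a, b]) \<in> Der)"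
    using as0 ex by metis
  finally show ?thesis .
qed

lemma bilin_mul: "bilin mul"
  using mul_linear_left mul_linear_right by (simp add: bilin_def)

text \<open>The Lie axioms are already translated. For the Leibniz rule the twist sign depends only
  on \<open>a\<close> and cancels, and commutativity reverses the last product to give the
  derivation rule.\<close>

lemma odd_poisson_twist:
  assumes f: "bilin f"
  shows "odd_poisson (twist f) \<longleftrightarrow> odd_symmetric f \<and> square_zero f \<and> (\<forall>a. f a \<in> Der)"
proof -
  define leib where "leib i j a b c \<longleftrightarrow>
    twist f a (b \<bullet> c) = twist f a b \<bullet> c + psign ((i + 1) * j) *s (b \<bullet> twist f a c)" for i j a b c
  define der where "der j l a b c \<longleftrightarrow>
    f a (b \<bullet> c) = f a b \<bullet> c + psign (j * l) *s (f a c \<bullet> b)" for j l a b c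
  note t = bilin_twist[OF f]
  have leib_iff_der: "leib i j a b c \<longleftrightarrow> der j l a b c"
    if "odd_symmetric f" and a: "a \<in> G i" and b: "b \<in> G j" and c: "c \<in> G l" for i j l a b c
  proof -
    \<comment> \<open>With this parity, commuting \<open>b\<close> past \<open>f a c\<close> costs
      \<open>psign (j * (i + l + 1))\<close>; combined with \<open>psign ((i + 1) * j)\<close> it
      leaves \<open>psign (j * l)\<close>.\<close>
    have "f a c \<in> G (i + l + 1)" using that unfolding odd_symmetric_def by blast
    note comm = mul_comm[OF b this]
    thus ?thesis
      unfolding leib_def der_def twist_homogeneous[OF f a] bilinD[OF bilin_mul] comm
      using bit_cases[of i] bit_cases[of j] bit_cases[of l]
      by (elim disjE) (simp_all add: neg_eq_iff_add_eq_0 eq_neg_iff_add_eq_0, simp_all add: algebra_simps)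
  qed
  have "(\<forall>i j. \<forall>a\<in>G i. \<forall>b\<in>G j. \<forall>c. leib i j a b c) \<longleftrightarrow>
      (\<forall>i j l. \<forall>a\<in>G i. \<forall>b\<in>G j. \<forall>c\<in>G l. leib i j a b c)"
  proof -
    \<comment> \<open>The Leibniz rule allows any \<open>c\<close>, the derivation rule only
      homogeneous ones; linearity in \<open>c\<close> bridges the gap.\<close>
    have "leib i j a b c" if "\<And>l c. c \<in> G l \<Longrightarrow> leib i j a b c" for i j a b c
    proof -
      have "Vector_Spaces.linear scale scale (\<lambda>c. twist f a (b \<bullet> c))"
        "Vector_Spaces.linear scale scale
          (\<lambda>c. twist f a b \<bullet> c + psign ((i + 1) * j) *s (b \<bullet> twist f a c))"
        unfolding linear_scale_iff
        by (simp_all add: bilinD[OF t] bilinD[OF bilin_mul] scale_right_distrib scale_left_commute)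
      from linear_eqI_homogeneous[OF this] that show ?thesis unfolding leib_def by blast
    qed
    thus ?thesis by meson
  qed
  moreover have "(\<forall>a. f a \<in> Der) \<longleftrightarrow> (\<forall>i j l. \<forall>a\<in>G i. \<forall>b\<in>G j. \<forall>c\<in>G l. der j l a b c)"
  proof -
    \<comment> \<open>Here \<open>a\<close> is the unrestricted argument, as every
      \<open>f a\<close> must be a derivation; linearity in \<open>a\<close> reduces to homogeneous
      \<open>a\<close>.\<close>
    have "der j l a b c" if "\<And>i a. a \<in> G i \<Longrightarrow> der j l a b c" for j l a b c
    proof -
      have "Vector_Spaces.linear scale scale (\<lambda>a. f a (b \<bullet> c))"
        "Vector_Spaces.linear scale scale (\<lambda>a. f a b \<bullet> c + psign (j * l) *s (f a c \<bullet> b))"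
        unfolding linear_scale_iff
        by (simp_all add: bilinD[OF f] bilinD[OF bilin_mul] scale_right_distrib scale_left_commute)
      from linear_eqI_homogeneous[OF this] that show ?thesis unfolding der_def by blast
    qed
    moreover have "f a \<in> Der \<longleftrightarrow> (\<forall>j l. \<forall>b\<in>G j. \<forall>c\<in>G l. der j l a b c)" for a
      using f by (simp add: Der_def der_def bilin_def)
    ultimately show ?thesis by meson
  qed
  ultimately show ?thesis
    unfolding odd_poisson_def lie_superalgebra_twist[OF f] leib_def[symmetric]
    using leib_iff_der by meson
qed


lemma bij_betw_bracket_of:
  "bij_betw bracket_of {X \<in> W_as 1. has_parity 1 X \<and> W_bracket X X = (\<lambda>_. 0)} {br. odd_poisson br}"
proof -
  let ?f = "\<lambda>X a b. X [a, b]"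
  have br: "bracket_of X = twist (?f X)" for X
    by (simp add: fun_eq_iff bracket_of_def twist_def)
  have "W_as 1 \<subseteq> W 1" by (subst W_as.simps) auto
  \<comment> \<open>Both sides of the correspondence now impose the same condition on the binary
    part of \<open>X\<close>.\<close>
  hence dom: "X \<in> W_as 1 \<and> has_parity 1 X \<and> W_bracket X X = (\<lambda>_. 0) \<longleftrightarrow>
      odd_W1 X \<and> odd_poisson (twist (?f X))" for X
    using odd_W1_iff[of X] W_as_1_iff[of X] W_bracket_self_eq_0_iff[of X]
      odd_poisson_twist[OF odd_W1D(2), of X] unfolding odd_W1_def by blast
  show ?thesis
  proof (rule bij_betw_imageI)
    show "inj_on bracket_of {X \<in> W_as 1. has_parity 1 X \<and> W_bracket X X = (\<lambda>_. 0)}"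
    proof (rule inj_onI, unfold mem_Collect_eq dom br)
      fix X X' assume X: "odd_W1 X \<and> odd_poisson (twist (?f X))"
        and X': "odd_W1 X' \<and> odd_poisson (twist (?f X'))" and eq: "twist (?f X) = twist (?f X')"
      \<comment> \<open>A second twist recovers the binary parts from the bracket.\<close>
      have f: "?f X = ?f X'"
        using eq twist_twist[OF odd_W1D(2), of X] twist_twist[OF odd_W1D(2), of X'] X X' by metis
      show "X = X'"
      proof
        fix vs show "X vs = X' vs"
        proof (cases "length vs = 2")
          case True
          then obtain a b where "vs = [a, b]" by (auto simp: length_Suc_conv numeral_2_eq_2)
          thus ?thesis using f by metis
        qed (use X X' odd_W1D(1) in metis)
      qed
    qed
    show "bracket_of ` {X \<in> W_as 1. has_parity 1 X \<and> W_bracket X X = (\<lambda>_. 0)} = {br. odd_poisson br}"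
    proof (intro equalityI subsetI)
      fix g assume "g \<in> {br. odd_poisson br}"
      hence g: "odd_poisson g" by simp
      hence b: "bilin g" unfolding odd_poisson_def lie_superalgebra_parity_rev by blast
      \<comment> \<open>Since \<open>twist\<close> is an involution, the preimage must have binary
        part \<open>twist g\<close>; the value 0 at other lengths is what \<open>W 1\<close>
        demands.\<close>
      define X where "X vs = (if length vs = 2 then twist g (vs ! 0) (vs ! 1) else 0)" for vs
      have f: "?f X = twist g" by (simp add: X_def fun_eq_iff)
      have "odd_symmetric (twist g)"
        using odd_poisson_twist[OF bilin_twist[OF b]] g by (simp add: twist_twist[OF b])
      hence "odd_W1 X" unfolding odd_W1_def f by (simp add: X_def)
      moreover have "g = bracket_of X" by (simp add: br f twist_twist[OF b])
      ultimately show "g \<in> bracket_of ` {X \<in> W_as 1. has_parity 1 X \<and> W_bracket X X = (\<lambda>_. 0)}"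
        unfolding image_iff bex_simps using dom[of X] br[of X] g by auto
    qed (use dom br in auto)
  qed
qed

end

theorem proposition3p13:
  fixes scale :: "'f::field_char_0 \<Rightarrow> 'a::ab_group_add \<Rightarrow> 'a"
    and G :: "bit \<Rightarrow> 'a set"
    and mul :: "'a \<Rightarrow> 'a \<Rightarrow> 'a"
  assumes "comm_assoc_superalgebra scale G mul"
  shows "bij_betw (comm_assoc_superalgebra.bracket_of scale G)
    {X \<in> comm_assoc_superalgebra.W_as scale G mul 1.
       superspace.has_parity G 1 X \<and> superspace.W_bracket scale G X X = (\<lambda>_. 0)}
    {br. comm_assoc_superalgebra.odd_poisson scale G mul br}"
  using assms by (rule comm_assoc_superalgebra.bij_betw_bracket_of)

end
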